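(* Let $S$ be a pomonoid and let $A_S$, $B_S$ be right $S$-posets. In each of the following cases, $\mathbf{Pos}_S(A_S\times B_S,B_S)$ is a generator in $\mathrm{End}(B_S)\text{-}\mathbf{Pos}$: (i) $A_S$ is an Emb-injective $S$-poset; (ii) there is an $S$-poset map $f:A_S\to B_S$ that is an Emb-injective object in the slice category $\mathbf{Pos}\text{-}S/B_S$.
   Context: A pomonoid is a monoid $S$ with a partial order $\leq$ such that $s\leq t$ and $s'\leq t'$ imply $ss'\leq tt'$. A (right) $S$-poset is a poset $A$ with a right monoid action $A\times S\to A$ that is order-preserving for the componentwise order on $A\times S$. $\mathbf{Pos}\text{-}S$ is the category of right $S$-posets with monotone action-preserving maps ($S$-poset maps); for a pomonoid $T$, $T\text{-}\mathbf{Pos}$ is the analogous category of left $T$-posets. $A_S\times B_S$ is the product, with componentwise order and action. An object $G$ is a generator if for any two distinct morphisms $\alpha,\beta:X\to Y$ there is a morphism $g:G\to X$ with $\alpha g\neq\beta g$. $\mathbf{Pos}_S(X,Y)$ is the set of $S$-poset maps $X\to Y$ with pointwise order; $\mathrm{End}(Y)=\mathbf{Pos}_S(Y,Y)$ is a pomonoid under composition, and $\mathbf{Pos}_S(X,Y)$ is a left $\mathrm{End}(Y)$-poset via $t\cdot g=t\circ g$. Emb is the class of order-embeddings ($S$-poset maps $h$ with $h(x)\leq h(y)\iff x\leq y$). An $S$-poset $A$ is Emb-injective if for every order-embedding $h:U\to V$ and $S$-poset map $u:U\to A$ there is an $S$-poset map $s:V\to A$ with $sh=u$. Objects of $\mathbf{Pos}\text{-}S/B_S$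 are $S$-poset maps with codomain $B_S$, morphisms are commutative triangles over $B_S$. An object $f:A_S\to B_S$ is Emb-injective in $\mathbf{Pos}\text{-}S/B_S$ if for every order-embedding $h:U\to V$ of $S$-posets and $S$-poset maps $u:U\to A_S$, $v:V\to B_S$ with $fu=vh$, there is an $S$-poset map $s:V\to A_S$ with $sh=u$ and $fs=v$. *)

theory Defs
  imports "HOL-Algebra.Group" "HOL-Library.FuncSet"
begin

section \<open>Pomonoids and posets with an action\<close>

record 's pomonoid = "'s monoid" +
  mleq :: "'s rel"

locale pomonoid = monoid S for S :: "'s pomonoid" +
  assumes mleq_order: "partial_order_on (carrier S) (mleq S)"
    and mult_mono: "(s, t) \<in> mleq S \<Longrightarrow> (s', t') \<in> mleq S
      \<Longrightarrow> (s \<otimes>\<^bsub>S\<^esub> s', t \<otimes>\<^bsub>S\<^esub> t') \<in> mleq S"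

record 'a poset = "'a partial_object" +
  leq :: "'a rel"

record ('s, 'a) rposet = "'a poset" +
  ract :: "'a \<Rightarrow> 's \<Rightarrow> 'a"

record ('t, 'a) lposet = "'a poset" +
  lact :: "'t \<Rightarrow> 'a \<Rightarrow> 'a"

text \<open>Carriers may be empty.\<close>

locale right_sposet = pomonoid S for S :: "'s pomonoid" +
  fixes A :: "('s, 'a) rposet"
  assumes leq_order: "partial_order_on (carrier A) (leq A)"
    and ract_closed: "a \<in> carrier A \<Longrightarrow> s \<in> carrier S \<Longrightarrow> ract A a s \<in> carrier A"
    and ract_one: "a \<in> carrier A \<Longrightarrow> ract A a \<one>\<^bsub>S\<^esub> = a"
    and ract_mult: "a \<in> carrier A \<Longrightarrow> s \<in> carrier S \<Longrightarrow> t \<in> carrier S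
      \<Longrightarrow> ract A a (s \<otimes>\<^bsub>S\<^esub> t) = ract A (ract A a s) t"
    and ract_mono: "(a, b) \<in> leq A \<Longrightarrow> (s, t) \<in> mleq S \<Longrightarrow> (ract A a s, ract A b t) \<in> leq A"

locale left_tposet = pomonoid T for T :: "'t pomonoid" +
  fixes X :: "('t, 'x) lposet"
  assumes leq_order: "partial_order_on (carrier X) (leq X)"
    and lact_closed: "t \<in> carrier T \<Longrightarrow> x \<in> carrier X \<Longrightarrow> lact X t x \<in> carrier X"
    and lact_one: "x \<in> carrier X \<Longrightarrow> lact X \<one>\<^bsub>T\<^esub> x = x"
    and lact_mult: "s \<in> carrier T \<Longrightarrow> t \<in> carrier T \<Longrightarrow> x \<in> carrier X
      \<Longrightarrow> lact X (s \<otimes>\<^bsub>T\<^esub> t) x = lact X s (lact X t x)"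
    and lact_mono: "(s, t) \<in> mleq T \<Longrightarrow> (x, y) \<in> leq X \<Longrightarrow> (lact X s x, lact X t y) \<in> leq X"

text \<open>Maps are extensional, i.e. \<open>undefined\<close> outside the carrier of their domain, so that
  equality of HOL functions is equality of morphisms and the pointwise order is antisymmetric.\<close>

definition right_maps :: "'s pomonoid \<Rightarrow> ('s, 'a) rposet \<Rightarrow> ('s, 'b) rposet \<Rightarrow> ('a \<Rightarrow> 'b) set" where
  "right_maps S X Y = {f \<in> carrier X \<rightarrow>\<^sub>E carrier Y.
     (\<forall>x y. (x, y) \<in> leq X \<longrightarrow> (f x, f y) \<in> leq Y) \<and>
     (\<forall>x\<in>carrier X. \<forall>s\<in>carrier S. f (ract X x s) = ract Y (f x) s)}"

definition left_maps :: "'t pomonoid \<Rightarrow> ('t, 'x) lposet \<Rightarrow> ('t, 'y) lposet \<Rightarrow> ('x \<Rightarrow> 'y) set" where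
  "left_maps T X Y = {f \<in> carrier X \<rightarrow>\<^sub>E carrier Y.
     (\<forall>x y. (x, y) \<in> leq X \<longrightarrow> (f x, f y) \<in> leq Y) \<and>
     (\<forall>t\<in>carrier T. \<forall>x\<in>carrier X. f (lact X t x) = lact Y t (f x))}"

definition order_embeddings :: "'s pomonoid \<Rightarrow> ('s, 'a) rposet \<Rightarrow> ('s, 'b) rposet \<Rightarrow> ('a \<Rightarrow> 'b) set" where
  "order_embeddings S X Y = {h \<in> right_maps S X Y.
     \<forall>x\<in>carrier X. \<forall>y\<in>carrier X. (h x, h y) \<in> leq Y \<longleftrightarrow> (x, y) \<in> leq X}"

definition prod_rposet :: "('s, 'a) rposet \<Rightarrow> ('s, 'b) rposet \<Rightarrow> ('s, 'a \<times> 'b) rposet" where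
  "prod_rposet A B = \<lparr>carrier = carrier A \<times> carrier B,
     leq = {((a, b), (a', b')). (a, a') \<in> leq A \<and> (b, b') \<in> leq B},
     ract = (\<lambda>(a, b) s. (ract A a s, ract B b s))\<rparr>"

definition pointwise_leq ::
  "'s pomonoid \<Rightarrow> ('s, 'a) rposet \<Rightarrow> ('s, 'b) rposet \<Rightarrow> ('a \<Rightarrow> 'b) rel" where
  "pointwise_leq S X Y = {(f, g). f \<in> right_maps S X Y \<and> g \<in> right_maps S X Y \<and>
     (\<forall>x\<in>carrier X. (f x, g x) \<in> leq Y)}"

definition End_pomonoid :: "'s pomonoid \<Rightarrow> ('s, 'b) rposet \<Rightarrow> ('b \<Rightarrow> 'b) pomonoid" where
  "End_pomonoid S Y = \<lparr>carrier = right_maps S Y Y,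
     mult = (\<lambda>t t'. compose (carrier Y) t t'),
     one = (\<lambda>y\<in>carrier Y. y),
     mleq = pointwise_leq S Y Y\<rparr>"

definition Pos_hom ::
  "'s pomonoid \<Rightarrow> ('s, 'a) rposet \<Rightarrow> ('s, 'b) rposet \<Rightarrow> ('b \<Rightarrow> 'b, 'a \<Rightarrow> 'b) lposet" where
  "Pos_hom S X Y = \<lparr>carrier = right_maps S X Y,
     leq = pointwise_leq S X Y,
     lact = (\<lambda>t g. compose (carrier X) t g)\<rparr>"

text \<open>The test objects range over all left posets with carriers in the types \<open>'x\<close> and \<open>'y\<close>;
  used in a conclusion with \<open>'x\<close> and \<open>'y\<close> free type variables, this covers all of them.\<close>

definition generator :: "'x itself \<Rightarrow> 'y itself \<Rightarrow> 't pomonoid \<Rightarrow> ('t, 'g) lposet \<Rightarrow> bool" where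
  "generator (_ :: 'x itself) (_ :: 'y itself) T G \<longleftrightarrow> left_tposet T G \<and>
     (\<forall>(X :: ('t, 'x) lposet) (Y :: ('t, 'y) lposet). left_tposet T X \<longrightarrow> left_tposet T Y \<longrightarrow>
       (\<forall>\<alpha>\<in>left_maps T X Y. \<forall>\<beta>\<in>left_maps T X Y. \<alpha> \<noteq> \<beta> \<longrightarrow>
         (\<exists>g\<in>left_maps T G X. compose (carrier G) \<alpha> g \<noteq> compose (carrier G) \<beta> g)))"

section \<open>Emb-injectivity\<close>

text \<open>HOL cannot quantify over types inside a formula, so the test embeddings \<open>h : U \<rightarrow> V\<close> are
  taken between \<open>S\<close>-posets with carriers in a fixed type. The types chosen are large enough for
  this to be no restriction: they contain an embedding of \<open>A\<close> into an injective object. The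
  lemmas \<open>emb_injective_extension\<close> and \<open>slice_emb_injective_extension\<close> below show that the
  extension property then holds for \<open>U\<close> and \<open>V\<close> with carriers in arbitrary types.\<close>

definition emb_injective :: "'s pomonoid \<Rightarrow> ('s, 'a) rposet \<Rightarrow> bool" where
  "emb_injective S A \<longleftrightarrow>
     (\<forall>(U :: ('s, 's \<Rightarrow> 'a set) rposet) (V :: ('s, 's \<Rightarrow> 'a set) rposet).
       right_sposet S U \<longrightarrow> right_sposet S V \<longrightarrow>
       (\<forall>h\<in>order_embeddings S U V. \<forall>u\<in>right_maps S U A.
         \<exists>s\<in>right_maps S V A. compose (carrier U) s h = u))"

definition slice_emb_injective ::
  "'s pomonoid \<Rightarrow> ('s, 'a) rposet \<Rightarrow> ('s, 'b) rposet \<Rightarrow> ('a \<Rightarrow> 'b) \<Rightarrow> bool" where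
  "slice_emb_injective S A B f \<longleftrightarrow>
     (\<forall>(U :: ('s, 'b \<times> ('s \<Rightarrow> 'a set)) rposet) (V :: ('s, 'b \<times> ('s \<Rightarrow> 'a set)) rposet).
       right_sposet S U \<longrightarrow> right_sposet S V \<longrightarrow>
       (\<forall>h\<in>order_embeddings S U V. \<forall>u\<in>right_maps S U A. \<forall>v\<in>right_maps S V B.
         compose (carrier U) f u = compose (carrier U) v h \<longrightarrow>
         (\<exists>s\<in>right_maps S V A. compose (carrier U) s h = u \<and> compose (carrier V) f s = v)))"

subsection \<open>Independence of the chosen types\<close>

lemma right_mapsI:
  assumes "f \<in> carrier X \<rightarrow>\<^sub>E carrier Y"
    and "\<And>x y. (x, y) \<in> leq X \<Longrightarrow> (f x, f y) \<in> leq Y"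
    and "\<And>x s. x \<in> carrier X \<Longrightarrow> s \<in> carrier S \<Longrightarrow> f (ract X x s) = ract Y (f x) s"
  shows "f \<in> right_maps S X Y"
  using assms unfolding right_maps_def by blast

lemma right_mapsD:
  assumes "f \<in> right_maps S X Y"
  shows "f \<in> carrier X \<rightarrow>\<^sub>E carrier Y"
    and "x \<in> carrier X \<Longrightarrow> f x \<in> carrier Y"
    and "(x, y) \<in> leq X \<Longrightarrow> (f x, f y) \<in> leq Y"
    and "x \<in> carrier X \<Longrightarrow> s \<in> carrier S \<Longrightarrow> f (ract X x s) = ract Y (f x) s"
  using assms unfolding right_maps_def by auto

lemma order_embeddingsD:
  assumes "h \<in> order_embeddings S X Y"
  shows "h \<in> right_maps S X Y"
    and "x \<in> carrier X \<Longrightarrow> y \<in> carrier X \<Longrightarrow> (h x, h y) \<in> leq Y \<longleftrightarrow> (x, y) \<in> leq X"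
  using assms unfolding order_embeddings_def by auto

context right_sposet
begin

lemma leq_carrier: "(x, y) \<in> leq A \<Longrightarrow> x \<in> carrier A \<and> y \<in> carrier A"
  using partial_order_onD(4)[OF leq_order] by auto

lemma leq_refl: "x \<in> carrier A \<Longrightarrow> (x, x) \<in> leq A"
  using partial_order_onD(1)[OF leq_order] by (auto simp: refl_on_def)

lemma leq_trans: "(x, y) \<in> leq A \<Longrightarrow> (y, z) \<in> leq A \<Longrightarrow> (x, z) \<in> leq A"
  using partial_order_onD(2)[OF leq_order] by (auto dest: transD)

lemma leq_antisym: "(x, y) \<in> leq A \<Longrightarrow> (y, x) \<in> leq A \<Longrightarrow> x = y"
  using partial_order_onD(3)[OF leq_order] by (auto dest: antisymD)

lemma mleq_carrier: "(s, t) \<in> mleq S \<Longrightarrow> s \<in> carrier S \<and> t \<in> carrier S"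
  using partial_order_onD(4)[OF mleq_order] by auto

lemma mleq_refl: "s \<in> carrier S \<Longrightarrow> (s, s) \<in> mleq S"
  using partial_order_onD(1)[OF mleq_order] by (auto simp: refl_on_def)

lemma substructure:
  assumes "C \<subseteq> carrier A" and "\<And>a s. a \<in> C \<Longrightarrow> s \<in> carrier S \<Longrightarrow> ract A a s \<in> C"
  shows "right_sposet S \<lparr>carrier = C, leq = leq A \<inter> C \<times> C, ract = ract A\<rparr>"
proof -
  have "partial_order_on C (leq A \<inter> C \<times> C)"
    using assms(1) leq_refl leq_trans leq_antisym
    unfolding partial_order_on_def preorder_on_def refl_on_def trans_def antisym_def by blast
  then show ?thesis
    using assms ract_one ract_mult ract_mono mleq_carrier
    by unfold_locales (auto simp: subset_iff)
qed

end

text \<open>The cofree \<open>S\<close>-poset of monotone maps from \<open>S\<close> to the complete lattice \<open>'a set\<close>.\<close>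

definition cofree :: "'s pomonoid \<Rightarrow> ('s, 's \<Rightarrow> 'a set) rposet" where
  "cofree S = (let C = {F \<in> carrier S \<rightarrow>\<^sub>E UNIV. \<forall>s t. (s, t) \<in> mleq S \<longrightarrow> F s \<subseteq> F t} in
     \<lparr>carrier = C,
      leq = {(F, G). F \<in> C \<and> G \<in> C \<and> (\<forall>t\<in>carrier S. F t \<subseteq> G t)},
      ract = (\<lambda>F s. \<lambda>t\<in>carrier S. F (s \<otimes>\<^bsub>S\<^esub> t))\<rparr>)"

definition cofree_emb :: "'s pomonoid \<Rightarrow> ('s, 'a) rposet \<Rightarrow> 'a \<Rightarrow> 's \<Rightarrow> 'a set" where
  "cofree_emb S A = (\<lambda>a\<in>carrier A. \<lambda>t\<in>carrier S. {x. (x, ract A a t) \<in> leq A})"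

lemma cofree_simps:
  "F \<in> carrier (cofree S) \<longleftrightarrow>
     F \<in> extensional (carrier S) \<and> (\<forall>s t. (s, t) \<in> mleq S \<longrightarrow> F s \<subseteq> F t)"
  "(F, G) \<in> leq (cofree S) \<longleftrightarrow>
     F \<in> carrier (cofree S) \<and> G \<in> carrier (cofree S) \<and> (\<forall>t\<in>carrier S. F t \<subseteq> G t)"
  "ract (cofree S) F s = (\<lambda>t\<in>carrier S. F (s \<otimes>\<^bsub>S\<^esub> t))"
  by (auto simp: cofree_def Let_def PiE_def)

lemma cofree_right_sposet:
  assumes "pomonoid S"
  shows "right_sposet S (cofree S :: ('s, 's \<Rightarrow> 'a set) rposet)"
proof -
  interpret pomonoid S by fact
  have mc: "(s, t) \<in> mleq S \<Longrightarrow> s \<in> carrier S \<and> t \<in> carrier S" for s t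
    using partial_order_onD(4)[OF mleq_order] by auto
  have mr: "s \<in> carrier S \<Longrightarrow> (s, s) \<in> mleq S" for s
    using partial_order_onD(1)[OF mleq_order] by (auto simp: refl_on_def)
  let ?E = "cofree S :: ('s, 's \<Rightarrow> 'a set) rposet"
  have closed: "ract ?E F s \<in> carrier ?E" if "F \<in> carrier ?E" "s \<in> carrier S" for F s
    using that mc mr mult_mono by (auto simp: cofree_simps)
  have anti: "F = G" if "(F, G) \<in> leq ?E" "(G, F) \<in> leq ?E" for F G
    using that by (auto simp: cofree_simps intro!: extensionalityI[of F "carrier S"])
  show ?thesis
  proof unfold_locales
    show "partial_order_on (carrier ?E) (leq ?E)"
      unfolding partial_order_on_def preorder_on_def refl_on_def trans_def antisym_def
      using anti by (auto simp: cofree_simps(2)) blast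
  next
    fix F assume "F \<in> carrier ?E"
    then show "ract ?E F \<one>\<^bsub>S\<^esub> = F"
      by (auto simp: cofree_simps extensional_def restrict_def fun_eq_iff)
  next
    fix F s t assume "F \<in> carrier ?E" "s \<in> carrier S" "t \<in> carrier S"
    then show "ract ?E F (s \<otimes>\<^bsub>S\<^esub> t) = ract ?E (ract ?E F s) t"
      by (auto simp: cofree_simps(3) m_assoc restrict_def fun_eq_iff)
  next
    fix F G s t assume FG: "(F, G) \<in> leq ?E" and st: "(s, t) \<in> mleq S"
    have "F (s \<otimes>\<^bsub>S\<^esub> r) \<subseteq> G (t \<otimes>\<^bsub>S\<^esub> r)" if r: "r \<in> carrier S" for r
    proof -
      have "F (s \<otimes>\<^bsub>S\<^esub> r) \<subseteq> F (t \<otimes>\<^bsub>S\<^esub> r)"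
        using FG mult_mono[OF st mr[OF r]] by (auto simp: cofree_simps)
      also have "\<dots> \<subseteq> G (t \<otimes>\<^bsub>S\<^esub> r)"
        using FG mc[OF st] r by (auto simp: cofree_simps(2))
      finally show ?thesis .
    qed
    then show "(ract ?E F s, ract ?E G t) \<in> leq ?E"
      using FG mc[OF st] closed[of F s] closed[of G t]
      by (auto simp: cofree_simps(2)) (auto simp: cofree_simps(3))
  qed (use closed in auto)
qed

lemma cofree_emb_order_embedding:
  assumes "right_sposet S A"
  shows "cofree_emb S A \<in> order_embeddings S A (cofree S)"
proof -
  interpret right_sposet S A by fact
  have e: "cofree_emb S A a t = {x. (x, ract A a t) \<in> leq A}"
    if "a \<in> carrier A" "t \<in> carrier S" for a t
    using that by (simp add: cofree_emb_def)
  have ext: "cofree_emb S A a \<in> extensional (carrier S)" if "a \<in> carrier A" for a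
    using that by (simp add: cofree_emb_def)
  have in_carrier: "cofree_emb S A a \<in> carrier (cofree S)" if a: "a \<in> carrier A" for a
  proof -
    have "cofree_emb S A a s \<subseteq> cofree_emb S A a t" if st: "(s, t) \<in> mleq S" for s t
      using mleq_carrier[OF st] ract_mono[OF leq_refl[OF a] st] leq_trans a
      by (auto simp: e)
    then show ?thesis using ext[OF a] by (auto simp: cofree_simps)
  qed
  have emb: "(cofree_emb S A a, cofree_emb S A b) \<in> leq (cofree S) \<longleftrightarrow> (a, b) \<in> leq A"
    if a: "a \<in> carrier A" and b: "b \<in> carrier A" for a b
  proof
    assume "(cofree_emb S A a, cofree_emb S A b) \<in> leq (cofree S)"
    then have "cofree_emb S A a \<one>\<^bsub>S\<^esub> \<subseteq> cofree_emb S A b \<one>\<^bsub>S\<^esub>"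
      by (simp add: cofree_simps(2))
    then show "(a, b) \<in> leq A"
      using a b leq_refl[OF a] by (auto simp: e ract_one)
  next
    assume ab: "(a, b) \<in> leq A"
    have "cofree_emb S A a t \<subseteq> cofree_emb S A b t" if t: "t \<in> carrier S" for t
      using ract_mono[OF ab mleq_refl[OF t]] leq_trans a b t by (auto simp: e)
    then show "(cofree_emb S A a, cofree_emb S A b) \<in> leq (cofree S)"
      using in_carrier a b by (simp add: cofree_simps(2))
  qed
  have act: "cofree_emb S A (ract A a s) = ract (cofree S) (cofree_emb S A a) s"
    if "a \<in> carrier A" "s \<in> carrier S" for a s
    using that by (intro extensionalityI[of _ "carrier S"])
      (auto simp: cofree_simps(3) e ract_closed ract_mult ext)
  have "cofree_emb S A \<in> right_maps S A (cofree S)"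
  proof (rule right_mapsI)
    show "cofree_emb S A \<in> carrier A \<rightarrow>\<^sub>E carrier (cofree S)"
      using in_carrier by (auto simp: PiE_def cofree_emb_def)
  qed (use emb leq_carrier act in auto)
  then show ?thesis using emb by (simp add: order_embeddings_def)
qed

lemma cofree_extension:
  assumes U: "right_sposet S U" and V: "right_sposet S V"
    and h: "h \<in> order_embeddings S U V" and w: "w \<in> right_maps S U (cofree S)"
  shows "\<exists>s\<in>right_maps S V (cofree S). \<forall>x\<in>carrier U. s (h x) = w x"
proof -
  interpret U: right_sposet S U by fact
  interpret V: right_sposet S V by fact
  note h' = order_embeddingsD[OF h]
  note hm = right_mapsD[OF h'(1)] and wm = right_mapsD[OF w]
  define s where "s = (\<lambda>v\<in>carrier V. \<lambda>t\<in>carrier S.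
    \<Union>{w x \<one>\<^bsub>S\<^esub> | x. x \<in> carrier U \<and> (h x, ract V v t) \<in> leq V})"
  have s: "s v t = \<Union>{w x \<one>\<^bsub>S\<^esub> | x. x \<in> carrier U \<and> (h x, ract V v t) \<in> leq V}"
    if "v \<in> carrier V" "t \<in> carrier S" for v t
    using that by (simp add: s_def)
  have ext: "s v \<in> extensional (carrier S)" if "v \<in> carrier V" for v
    using that by (simp add: s_def)
  have s_mono: "s v t \<subseteq> s v' t'" if vv: "(v, v') \<in> leq V" and tt: "(t, t') \<in> mleq S" for v v' t t'
    using V.leq_carrier[OF vv] V.mleq_carrier[OF tt] V.leq_trans[OF _ V.ract_mono[OF vv tt]]
    by (auto simp: s)
  have in_carrier: "s v \<in> carrier (cofree S)" if "v \<in> carrier V" for v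
    using that ext s_mono[OF V.leq_refl] by (auto simp: cofree_simps(1))
  have s_map: "s \<in> right_maps S V (cofree S)"
  proof (rule right_mapsI)
    show "s \<in> carrier V \<rightarrow>\<^sub>E carrier (cofree S)"
      using in_carrier by (auto simp: PiE_def s_def)
  next
    fix v v' assume vv: "(v, v') \<in> leq V"
    then show "(s v, s v') \<in> leq (cofree S)"
      using V.leq_carrier[OF vv] in_carrier s_mono[OF vv V.mleq_refl]
      by (auto simp: cofree_simps(2))
  next
    fix v r assume "v \<in> carrier V" "r \<in> carrier S"
    then show "s (ract V v r) = ract (cofree S) (s v) r"
      by (intro extensionalityI[of _ "carrier S"])
        (auto simp: cofree_simps(3) s V.ract_closed V.ract_mult ext)
  qed
  have "s (h y) = w y" if y: "y \<in> carrier U" for y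
  proof (rule extensionalityI[of _ "carrier S"])
    show "s (h y) \<in> extensional (carrier S)" using ext hm(2)[OF y] .
    show "w y \<in> extensional (carrier S)" using wm(2)[OF y] by (simp add: cofree_simps(1))
    fix t assume t: "t \<in> carrier S"
    have yt: "ract U y t \<in> carrier U" using U.ract_closed[OF y t] .
    have "s (h y) t = \<Union>{w x \<one>\<^bsub>S\<^esub> | x. x \<in> carrier U \<and> (x, ract U y t) \<in> leq U}"
      using s[OF hm(2)[OF y] t] h'(2)[OF _ yt] by (simp add: hm(4)[OF y t, symmetric] cong: conj_cong)
    also have "\<dots> = w (ract U y t) \<one>\<^bsub>S\<^esub>"
      using U.leq_refl[OF yt] yt wm(3) by (fastforce simp: cofree_simps(2))
    also have "\<dots> = w y t"
      using wm(4)[OF y t] t by (simp add: cofree_simps(3))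
    finally show "s (h y) t = w y t" .
  qed
  with s_map show ?thesis by blast
qed

text \<open>An \<open>S\<close>-poset embedded in \<open>E\<close> is isomorphic to its image, a subobject of \<open>E\<close>.\<close>

lemma image_subobject:
  assumes A: "right_sposet S A" and E: "right_sposet S E" and e: "e \<in> order_embeddings S A E"
  defines "I \<equiv> \<lparr>carrier = e ` carrier A, leq = leq E \<inter> (e ` carrier A) \<times> (e ` carrier A), ract = ract E\<rparr>"
  shows "right_sposet S I"
    and "(\<lambda>y\<in>e ` carrier A. y) \<in> order_embeddings S I E"
    and "(\<lambda>y\<in>e ` carrier A. the_inv_into (carrier A) e y) \<in> right_maps S I A"
    and "inj_on e (carrier A)"
proof -
  interpret A: right_sposet S A by fact
  interpret E: right_sposet S E by fact
  note e' = order_embeddingsD[OF e]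
  note em = right_mapsD[OF e'(1)]
  have act: "ract E (e a) s = e (ract A a s)" if "a \<in> carrier A" "s \<in> carrier S" for a s
    using em(4)[OF that] by simp
  show inj: "inj_on e (carrier A)"
    by (rule inj_onI) (metis A.leq_antisym A.leq_refl e'(2))
  note inv = the_inv_into_f_f[OF inj]
  show I: "right_sposet S I"
    unfolding I_def
    by (rule E.substructure) (use em(2) act A.ract_closed in auto)
  show "(\<lambda>y\<in>e ` carrier A. y) \<in> order_embeddings S I E"
    using em(2) act A.ract_closed
    by (auto simp: order_embeddings_def I_def intro!: right_mapsI)
  show "(\<lambda>y\<in>e ` carrier A. the_inv_into (carrier A) e y) \<in> right_maps S I A"
    using em(2) act A.ract_closed e'(2)
    by (auto simp: I_def inv intro!: right_mapsI) (metis A.ract_closed inj inj_onD)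
qed

lemma right_maps_compose:
  assumes X: "right_sposet S X" and "f \<in> right_maps S X Y" and "g \<in> right_maps S Y Z"
  shows "compose (carrier X) g f \<in> right_maps S X Z"
proof -
  interpret X: right_sposet S X by fact
  note f = right_mapsD[OF assms(2)] and g = right_mapsD[OF assms(3)]
  show ?thesis
    by (rule right_mapsI)
      (use f g X.leq_carrier X.ract_closed in \<open>auto simp: compose_def\<close>)
qed

theorem emb_injective_extension:
  fixes U :: "('s, 'u) rposet" and V :: "('s, 'v) rposet"
  assumes A: "right_sposet S A" and inj: "emb_injective S A"
    and U: "right_sposet S U" and V: "right_sposet S V"
    and h: "h \<in> order_embeddings S U V" and u: "u \<in> right_maps S U A"
  shows "\<exists>s\<in>right_maps S V A. compose (carrier U) s h = u"
proof -
  interpret A: right_sposet S A by fact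
  let ?E = "cofree S :: ('s, 's \<Rightarrow> 'a set) rposet"
  let ?e = "cofree_emb S A"
  have E: "right_sposet S ?E" using cofree_right_sposet A.pomonoid_axioms .
  have e: "?e \<in> order_embeddings S A ?E" using cofree_emb_order_embedding[OF A] .
  note I = image_subobject[OF A E e]
  obtain r where r: "r \<in> right_maps S ?E A"
    and re: "compose (?e ` carrier A) r (\<lambda>y\<in>?e ` carrier A. y)
      = (\<lambda>y\<in>?e ` carrier A. the_inv_into (carrier A) ?e y)"
    using inj I(1-3) E unfolding emb_injective_def by fastforce
  have ra: "r (?e a) = a" if "a \<in> carrier A" for a
    using fun_cong[OF re, of "?e a"] that the_inv_into_f_f[OF I(4)] by (simp add: compose_def)
  obtain s' where s': "s' \<in> right_maps S V ?E"
    and s'h: "\<forall>x\<in>carrier U. s' (h x) = compose (carrier U) ?e u x"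
    using cofree_extension[OF U V h right_maps_compose[OF U u order_embeddingsD(1)[OF e]]] by blast
  have "compose (carrier U) (compose (carrier V) r s') h = u"
    by (rule extensionalityI[of _ "carrier U"])
      (use right_mapsD[OF u] right_mapsD(2)[OF order_embeddingsD(1)[OF h]] s'h ra
        in \<open>auto simp: compose_def PiE_def\<close>)
  then show ?thesis using right_maps_compose[OF V s' r] by blast
qed

lemma prod_rposet_simps:
  "carrier (prod_rposet A B) = carrier A \<times> carrier B"
  "((a, b), (a', b')) \<in> leq (prod_rposet A B) \<longleftrightarrow> (a, a') \<in> leq A \<and> (b, b') \<in> leq B"
  "ract (prod_rposet A B) (a, b) s = (ract A a s, ract B b s)"
  by (auto simp: prod_rposet_def)

lemma prod_right_sposet:
  assumes "right_sposet S A" and "right_sposet S B"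
  shows "right_sposet S (prod_rposet A B)"
proof -
  interpret A: right_sposet S A by fact
  interpret B: right_sposet S B by fact
  have "refl_on (carrier (prod_rposet A B)) (leq (prod_rposet A B))"
    using A.leq_refl B.leq_refl by (auto simp: refl_on_def prod_rposet_simps)
  moreover have "leq (prod_rposet A B) \<subseteq> carrier (prod_rposet A B) \<times> carrier (prod_rposet A B)"
    using A.leq_carrier B.leq_carrier by (auto simp: prod_rposet_simps)
  moreover have "trans (leq (prod_rposet A B))"
    using A.leq_trans B.leq_trans by (fastforce simp: trans_def prod_rposet_simps)
  moreover have "antisym (leq (prod_rposet A B))"
    using A.leq_antisym B.leq_antisym by (auto simp: antisym_def prod_rposet_simps)
  ultimately have "partial_order_on (carrier (prod_rposet A B)) (leq (prod_rposet A B))"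
    by (simp add: partial_order_on_def preorder_on_def)
  then show ?thesis
    using A.ract_closed B.ract_closed A.ract_one B.ract_one A.ract_mult B.ract_mult
      A.ract_mono B.ract_mono
    by unfold_locales (auto simp: prod_rposet_simps)
qed

theorem slice_emb_injective_extension:
  fixes U :: "('s, 'u) rposet" and V :: "('s, 'v) rposet"
  assumes A: "right_sposet S A" and B: "right_sposet S B"
    and f: "f \<in> right_maps S A B" and inj: "slice_emb_injective S A B f"
    and U: "right_sposet S U" and V: "right_sposet S V"
    and h: "h \<in> order_embeddings S U V" and u: "u \<in> right_maps S U A" and v: "v \<in> right_maps S V B"
    and comm: "compose (carrier U) f u = compose (carrier U) v h"
  shows "\<exists>s\<in>right_maps S V A. compose (carrier U) s h = u \<and> compose (carrier V) f s = v"
proof -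
  interpret A: right_sposet S A by fact
  interpret B: right_sposet S B by fact
  interpret V: right_sposet S V by fact
  let ?E = "cofree S :: ('s, 's \<Rightarrow> 'a set) rposet"
  let ?P = "prod_rposet B ?E"
  let ?e = "cofree_emb S A"
  have E: "right_sposet S ?E" using cofree_right_sposet A.pomonoid_axioms .
  have P: "right_sposet S ?P" using prod_right_sposet[OF B E] .
  have e: "?e \<in> order_embeddings S A ?E" using cofree_emb_order_embedding[OF A] .
  note em = right_mapsD[OF order_embeddingsD(1)[OF e]]
  note fm = right_mapsD[OF f]
  note vm = right_mapsD[OF v]
  note um = right_mapsD[OF u]
  define d where "d = (\<lambda>a\<in>carrier A. (f a, ?e a))"
  have d: "d \<in> order_embeddings S A ?P"
  proof -
    have "d \<in> right_maps S A ?P"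
      by (rule right_mapsI)
        (use em fm A.leq_carrier A.ract_closed in \<open>auto simp: d_def prod_rposet_simps\<close>)
    then show ?thesis
      using order_embeddingsD(2)[OF e] fm(3)
      by (auto simp: order_embeddings_def d_def prod_rposet_simps)
  qed
  note I = image_subobject[OF A P d]
  let ?I = "\<lparr>carrier = d ` carrier A, leq = leq ?P \<inter> (d ` carrier A) \<times> (d ` carrier A), ract = ract ?P\<rparr>"
  let ?inv = "\<lambda>y\<in>d ` carrier A. the_inv_into (carrier A) d y"
  let ?inc = "\<lambda>y\<in>d ` carrier A. y"
  let ?fst = "\<lambda>y\<in>carrier ?P. fst y"
  have fst: "?fst \<in> right_maps S ?P B"
    by (rule right_mapsI)
      (use right_sposet.leq_carrier[OF P] right_sposet.ract_closed[OF P]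
        in \<open>auto simp: prod_rposet_simps\<close>)
  have comm': "compose (carrier ?I) f ?inv = compose (carrier ?I) ?fst ?inc"
    using the_inv_into_f_f[OF I(4)] em(2) fm(2)
    by (auto simp: compose_def d_def prod_rposet_simps restrict_def fun_eq_iff)
  obtain r where r: "r \<in> right_maps S ?P A"
    and re: "compose (carrier ?I) r ?inc = ?inv" and fr: "compose (carrier ?P) f r = ?fst"
    using inj[unfolded slice_emb_injective_def, rule_format, OF I(1) P I(2) I(3) fst comm'] by blast
  have ra: "r (f a, ?e a) = a" if "a \<in> carrier A" for a
    using fun_cong[OF re, of "d a"] that the_inv_into_f_f[OF I(4)]
    by (simp add: compose_def d_def)
  have fr': "f (r y) = fst y" if "y \<in> carrier ?P" for y
    using fun_cong[OF fr, of y] that by (simp add: compose_def)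
  obtain s' where s': "s' \<in> right_maps S V ?E"
    and s'h: "\<forall>x\<in>carrier U. s' (h x) = compose (carrier U) ?e u x"
    using cofree_extension[OF U V h right_maps_compose[OF U u order_embeddingsD(1)[OF e]]] by blast
  note s'm = right_mapsD[OF s']
  let ?p = "\<lambda>y\<in>carrier V. (v y, s' y)"
  have p: "?p \<in> right_maps S V ?P"
    by (rule right_mapsI)
      (use vm s'm V.leq_carrier V.ract_closed in \<open>auto simp: prod_rposet_simps\<close>)
  have hV: "h x \<in> carrier V" if "x \<in> carrier U" for x
    using right_mapsD(2)[OF order_embeddingsD(1)[OF h] that] .
  have vh: "v (h x) = f (u x)" if "x \<in> carrier U" for x
    using fun_cong[OF comm, of x] that by (simp add: compose_def)
  let ?s = "compose (carrier V) r ?p"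
  have "compose (carrier U) ?s h = u"
    by (rule extensionalityI[of _ "carrier U"])
      (use um hV vh s'h ra in \<open>auto simp: compose_def PiE_def\<close>)
  moreover have "compose (carrier V) f ?s = v"
    by (rule extensionalityI[of _ "carrier V"])
      (use vm s'm fr' in \<open>auto simp: compose_def PiE_def prod_rposet_simps\<close>)
  ultimately show ?thesis using right_maps_compose[OF V p r] by blast
qed

end

theory Submission
  imports Defs
begin

text \<open>Injectivity, tested on the embedding of the empty \<open>S\<close>-poset into \<open>B\<close>, gives an \<open>S\<close>-poset
  map \<open>k : B \<rightarrow> A\<close>, so the projection \<open>A \<times> B \<rightarrow> B\<close> is split by \<open>b \<mapsto> (k b, b)\<close>. Precomposition
  with this section is a map of left \<open>End(B)\<close>-posets from the hom-poset to \<open>End(B)\<close> sending the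
  projection to \<open>1\<close>. Followed by the orbit map \<open>t \<mapsto> t x\<close> of a point \<open>x\<close> with
  \<open>\<alpha> x \<noteq> \<beta> x\<close>, it separates \<open>\<alpha>\<close> and \<open>\<beta>\<close>.\<close>

section \<open>Pointwise order and composition of \<open>S\<close>-poset maps\<close>

lemma pointwise_leq_partial_order:
  assumes X: "right_sposet S X" and Y: "right_sposet S Y"
  shows "partial_order_on (right_maps S X Y) (pointwise_leq S X Y)"
proof -
  interpret Y: right_sposet S Y by fact
  have "refl_on (right_maps S X Y) (pointwise_leq S X Y)"
    using Y.leq_refl by (auto simp: refl_on_def pointwise_leq_def dest: right_mapsD(2))
  moreover have "pointwise_leq S X Y \<subseteq> right_maps S X Y \<times> right_maps S X Y"
    by (auto simp: pointwise_leq_def)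
  moreover have "trans (pointwise_leq S X Y)"
    using Y.leq_trans by (fastforce simp: trans_def pointwise_leq_def)
  \<comment> \<open>Mutual comparison gives equality only on \<open>carrier X\<close>;
    extensionality of the maps turns this into equality of functions.\<close>
  moreover have "antisym (pointwise_leq S X Y)"
  proof (rule antisymI)
    fix f g assume "(f, g) \<in> pointwise_leq S X Y" "(g, f) \<in> pointwise_leq S X Y"
    then have "f \<in> carrier X \<rightarrow>\<^sub>E carrier Y" "g \<in> carrier X \<rightarrow>\<^sub>E carrier Y"
      "\<And>x. x \<in> carrier X \<Longrightarrow> f x = g x"
      using Y.leq_antisym by (auto simp: pointwise_leq_def right_maps_def)
    then show "f = g" by (rule PiE_ext)
  qed
  ultimately show ?thesis by (simp add: partial_order_on_def preorder_on_def)
qed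

text \<open>At each point \<open>g (f x)\<close> lies below \<open>g (f' x)\<close> by monotonicity
  of \<open>g\<close>, and this lies below \<open>g' (f' x)\<close> by comparing \<open>g\<close>
  with \<open>g'\<close> at \<open>f' x\<close>. This supplies the order law both for multiplication
  in \<open>End(B)\<close> and for its action.\<close>

lemma compose_pointwise_mono:
  assumes X: "right_sposet S X" and Z: "right_sposet S Z"
    and f: "(f, f') \<in> pointwise_leq S X Y" and g: "(g, g') \<in> pointwise_leq S Y Z"
  shows "(compose (carrier X) g f, compose (carrier X) g' f') \<in> pointwise_leq S X Z"
proof -
  interpret Z: right_sposet S Z by fact
  have m: "f \<in> right_maps S X Y" "f' \<in> right_maps S X Y"
    "g \<in> right_maps S Y Z" "g' \<in> right_maps S Y Z"
    using f g by (auto simp: pointwise_leq_def)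
  have "(g (f x), g' (f' x)) \<in> leq Z" if x: "x \<in> carrier X" for x
  proof (rule Z.leq_trans)
    show "(g (f x), g (f' x)) \<in> leq Z"
      using f x right_mapsD(3)[OF m(3)] by (auto simp: pointwise_leq_def)
    show "(g (f' x), g' (f' x)) \<in> leq Z"
      using g right_mapsD(2)[OF m(2) x] by (auto simp: pointwise_leq_def)
  qed
  then show ?thesis
    using right_maps_compose[OF X m(1,3)] right_maps_compose[OF X m(2,4)]
    by (simp add: pointwise_leq_def compose_eq)
qed

lemma right_maps_id:
  assumes "right_sposet S X"
  shows "(\<lambda>x\<in>carrier X. x) \<in> right_maps S X X"
  using right_sposet.leq_carrier[OF assms] right_sposet.ract_closed[OF assms]
  by (auto intro!: right_mapsI)

lemma compose_id_left:
  assumes "f \<in> right_maps S X Y"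
  shows "compose (carrier X) (\<lambda>y\<in>carrier Y. y) f = f"
  using assms by (intro Id_compose) (auto simp: right_maps_def PiE_def)

lemma compose_id_right:
  assumes "f \<in> right_maps S X Y"
  shows "compose (carrier X) f (\<lambda>x\<in>carrier X. x) = f"
  using assms by (intro compose_Id) (auto simp: right_maps_def PiE_def)

text \<open>Since \<open>f\<close> maps into \<open>carrier X\<close>, the restriction built into
  \<open>compose (carrier X) h g\<close> is invisible after \<open>f\<close>. Keeping
  \<open>W\<close> and \<open>X\<close> distinct lets the same equation serve multiplication in
  \<open>End(B)\<close>, its action on a hom-poset, and precomposition.\<close>

lemma right_maps_compose_assoc:
  assumes "f \<in> right_maps S W X"
  shows "compose (carrier W) (compose (carrier X) h g) f
    = compose (carrier W) h (compose (carrier W) g f)"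
  using right_mapsD(2)[OF assms] by (auto simp: compose_def restrict_def fun_eq_iff)

section \<open>The pomonoid \<open>End(B)\<close> and its left posets of maps\<close>

lemma End_pomonoid:
  assumes B: "right_sposet S B"
  shows "pomonoid (End_pomonoid S B)"
proof -
  let ?T = "End_pomonoid S B"
  have simps: "carrier ?T = right_maps S B B" "mult ?T = compose (carrier B)"
    "one ?T = (\<lambda>y\<in>carrier B. y)" "mleq ?T = pointwise_leq S B B"
    by (simp_all add: End_pomonoid_def)
  show ?thesis
  proof (unfold_locales, unfold simps)
    fix f g h assume m: "f \<in> right_maps S B B" "g \<in> right_maps S B B" "h \<in> right_maps S B B"
    show "compose (carrier B) f g \<in> right_maps S B B" using right_maps_compose[OF B m(2,1)] .
    show "compose (carrier B) (compose (carrier B) f g) h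
        = compose (carrier B) f (compose (carrier B) g h)"
      using right_maps_compose_assoc[OF m(3)] .
  next
    show "(\<lambda>y\<in>carrier B. y) \<in> right_maps S B B" using right_maps_id[OF B] .
  next
    fix f assume m: "f \<in> right_maps S B B"
    show "compose (carrier B) (\<lambda>y\<in>carrier B. y) f = f" using compose_id_left[OF m] .
    show "compose (carrier B) f (\<lambda>y\<in>carrier B. y) = f" using compose_id_right[OF m] .
  next
    show "partial_order_on (right_maps S B B) (pointwise_leq S B B)"
      using pointwise_leq_partial_order[OF B B] .
  next
    fix s t s' t' assume "(s, t) \<in> pointwise_leq S B B" "(s', t') \<in> pointwise_leq S B B"
    then show "(compose (carrier B) s s', compose (carrier B) t t') \<in> pointwise_leq S B B"
      using compose_pointwise_mono[OF B B] by blast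
  qed
qed

text \<open>Endomorphisms act by composition on the left, so the action laws are the unit,
  associativity and monotonicity laws of composition.\<close>

lemma Pos_hom_left_tposet:
  assumes X: "right_sposet S X" and B: "right_sposet S B"
  shows "left_tposet (End_pomonoid S B) (Pos_hom S X B)"
proof -
  interpret T: pomonoid "End_pomonoid S B" using End_pomonoid[OF B] .
  let ?T = "End_pomonoid S B" and ?G = "Pos_hom S X B"
  have simps: "carrier ?T = right_maps S B B" "mult ?T = compose (carrier B)"
    "one ?T = (\<lambda>y\<in>carrier B. y)" "mleq ?T = pointwise_leq S B B"
    "carrier ?G = right_maps S X B" "leq ?G = pointwise_leq S X B"
    "lact ?G = compose (carrier X)"
    by (simp_all add: End_pomonoid_def Pos_hom_def)
  show ?thesis
  proof (unfold_locales, unfold simps)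
    show "partial_order_on (right_maps S X B) (pointwise_leq S X B)"
      using pointwise_leq_partial_order[OF X B] .
  next
    fix t g assume m: "t \<in> right_maps S B B" "g \<in> right_maps S X B"
    show "compose (carrier X) t g \<in> right_maps S X B" using right_maps_compose[OF X m(2,1)] .
  next
    fix g assume m: "g \<in> right_maps S X B"
    show "compose (carrier X) (\<lambda>y\<in>carrier B. y) g = g" using compose_id_left[OF m] .
  next
    fix s t g
    assume "s \<in> right_maps S B B" "t \<in> right_maps S B B" and m: "g \<in> right_maps S X B"
    show "compose (carrier X) (compose (carrier B) s t) g
        = compose (carrier X) s (compose (carrier X) t g)"
      using right_maps_compose_assoc[OF m] .
  next
    fix s t g g' assume "(s, t) \<in> pointwise_leq S B B" "(g, g') \<in> pointwise_leq S X B"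
    then show "(compose (carrier X) s g, compose (carrier X) t g') \<in> pointwise_leq S X B"
      using compose_pointwise_mono[OF X B] by blast
  qed
qed

text \<open>Two equivariant maps are chained: precomposition with \<open>\<gamma>\<close> into
  \<open>End(B)\<close>, where \<open>(t g) \<gamma> = t (g \<gamma>)\<close>, and the orbit map of
  \<open>x\<close>, where \<open>(t s) x = t (s x)\<close>.\<close>

lemma precompose_orbit_left_map:
  assumes P: "right_sposet S P" and B: "right_sposet S B" and \<gamma>: "\<gamma> \<in> right_maps S B P"
    and X: "left_tposet (End_pomonoid S B) X" and x: "x \<in> carrier X"
  shows "(\<lambda>g\<in>carrier (Pos_hom S P B). lact X (compose (carrier B) g \<gamma>) x)
    \<in> left_maps (End_pomonoid S B) (Pos_hom S P B) X"
proof -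
  interpret P: right_sposet S P by fact
  interpret X: left_tposet "End_pomonoid S B" X by fact
  \<comment> \<open>The monotonicity laws vary both arguments at once; reflexivity at
    \<open>x\<close> and at \<open>\<gamma>\<close> holds one argument fixed.\<close>
  have xx: "(x, x) \<in> leq X"
    using partial_order_onD(1)[OF X.leq_order] x by (auto simp: refl_on_def)
  have \<gamma>\<gamma>: "(\<gamma>, \<gamma>) \<in> pointwise_leq S B P"
    using \<gamma> P.leq_refl by (auto simp: pointwise_leq_def dest: right_mapsD(2))
  let ?T = "End_pomonoid S B" and ?G = "Pos_hom S P B"
  have simps: "carrier ?T = right_maps S B B" "mult ?T = compose (carrier B)"
    "mleq ?T = pointwise_leq S B B" "carrier ?G = right_maps S P B"
    "leq ?G = pointwise_leq S P B" "lact ?G = compose (carrier P)"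
    by (simp_all add: End_pomonoid_def Pos_hom_def)
  let ?g = "\<lambda>g\<in>right_maps S P B. lact X (compose (carrier B) g \<gamma>) x"
  have in_End: "compose (carrier B) g \<gamma> \<in> right_maps S B B" if "g \<in> right_maps S P B" for g
    using right_maps_compose[OF B \<gamma> that] .
  show ?thesis
    unfolding left_maps_def simps
  proof (intro CollectI conjI allI impI ballI)
    show "?g \<in> right_maps S P B \<rightarrow>\<^sub>E carrier X"
      using X.lact_closed[unfolded simps, OF in_End x] by (intro restrict_PiE_iff[THEN iffD2]) blast
  next
    fix g g' assume gg: "(g, g') \<in> pointwise_leq S P B"
    then have "g \<in> right_maps S P B" "g' \<in> right_maps S P B"
      by (simp_all add: pointwise_leq_def)
    then show "(?g g, ?g g') \<in> leq X"
      using X.lact_mono[unfolded simps, OF compose_pointwise_mono[OF B B \<gamma>\<gamma> gg] xx] by simp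
  next
    fix t g assume t: "t \<in> right_maps S B B" and g: "g \<in> right_maps S P B"
    have "?g (compose (carrier P) t g) = lact X (compose (carrier B) (compose (carrier P) t g) \<gamma>) x"
      using right_maps_compose[OF P g t] by simp
    also have "\<dots> = lact X (compose (carrier B) t (compose (carrier B) g \<gamma>)) x"
      by (simp only: right_maps_compose_assoc[OF \<gamma>])
    also have "\<dots> = lact X t (?g g)"
      using X.lact_mult[unfolded simps, OF t in_End[OF g] x] g by simp
    finally show "?g (compose (carrier P) t g) = lact X t (?g g)" .
  qed
qed

section \<open>Retracts and the generator property\<close>

text \<open>The retraction \<open>r\<close> is itself an element of the hom-poset, and the
  separating map sends it to \<open>(r \<gamma>) x = 1 x = x\<close>. Hence two maps that differ at
  \<open>x\<close> still differ after composition, at the element \<open>r\<close>.\<close>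

lemma generator_Pos_hom_of_retract:
  fixes S :: "'s pomonoid" and P :: "('s, 'p) rposet" and B :: "('s, 'b) rposet"
  assumes P: "right_sposet S P" and B: "right_sposet S B"
    and \<gamma>: "\<gamma> \<in> right_maps S B P" and r: "r \<in> right_maps S P B"
    and split: "compose (carrier B) r \<gamma> = (\<lambda>b\<in>carrier B. b)"
  shows "generator TYPE('x) TYPE('y) (End_pomonoid S B) (Pos_hom S P B)"
  unfolding generator_def
proof (intro conjI allI impI ballI)
  show "left_tposet (End_pomonoid S B) (Pos_hom S P B)"
    using Pos_hom_left_tposet[OF P B] .
next
  fix X :: "('b \<Rightarrow> 'b, 'x) lposet" and Y :: "('b \<Rightarrow> 'b, 'y) lposet" and \<alpha> \<beta>
  let ?T = "End_pomonoid S B" and ?G = "Pos_hom S P B"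
  assume X: "left_tposet ?T X" and \<alpha>: "\<alpha> \<in> left_maps ?T X Y"
    and \<beta>: "\<beta> \<in> left_maps ?T X Y" and "\<alpha> \<noteq> \<beta>"
  have "\<alpha> \<in> carrier X \<rightarrow>\<^sub>E carrier Y" "\<beta> \<in> carrier X \<rightarrow>\<^sub>E carrier Y"
    using \<alpha> \<beta> by (simp_all add: left_maps_def)
  \<comment> \<open>Extensional functions that are distinct must differ inside the carrier.\<close>
  then obtain x where x: "x \<in> carrier X" "\<alpha> x \<noteq> \<beta> x"
    using \<open>\<alpha> \<noteq> \<beta>\<close> PiE_ext[of \<alpha> "carrier X" "\<lambda>_. carrier Y" \<beta>] by metis
  define g where "g = (\<lambda>q\<in>carrier ?G. lact X (compose (carrier B) q \<gamma>) x)"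
  have rG: "r \<in> carrier ?G" using r by (simp add: Pos_hom_def)
  have "g r = x"
    using rG left_tposet.lact_one[OF X x(1)] by (simp add: g_def split End_pomonoid_def)
  then have "compose (carrier ?G) \<alpha> g r \<noteq> compose (carrier ?G) \<beta> g r"
    using x(2) rG by (simp add: compose_eq)
  moreover have "g \<in> left_maps ?T ?G X"
    unfolding g_def using precompose_orbit_left_map[OF P B \<gamma> X x(1)] .
  ultimately show "\<exists>g\<in>left_maps ?T ?G X. compose (carrier ?G) \<alpha> g \<noteq> compose (carrier ?G) \<beta> g"
    by (intro bexI[of _ g]) auto
qed

text \<open>The section is the graph of \<open>k\<close> with its coordinates swapped; its second
  coordinate returns \<open>b\<close>. Thus any map \<open>k\<close> from \<open>B\<close> to
  \<open>A\<close> makes \<open>B\<close> a retract of the product.\<close>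

lemma prod_snd_section:
  assumes A: "right_sposet S A" and B: "right_sposet S B" and k: "k \<in> right_maps S B A"
  defines "\<gamma> \<equiv> \<lambda>b\<in>carrier B. (k b, b)"
    and "p \<equiv> \<lambda>y\<in>carrier (prod_rposet A B). snd y"
  shows "\<gamma> \<in> right_maps S B (prod_rposet A B)"
    and "p \<in> right_maps S (prod_rposet A B) B"
    and "compose (carrier B) p \<gamma> = (\<lambda>b\<in>carrier B. b)"
proof -
  interpret A: right_sposet S A by fact
  interpret B: right_sposet S B by fact
  note km = right_mapsD[OF k]
  show "\<gamma> \<in> right_maps S B (prod_rposet A B)"
    by (rule right_mapsI)
      (use km B.leq_carrier B.ract_closed in \<open>auto simp: \<gamma>_def prod_rposet_simps\<close>)
  show "p \<in> right_maps S (prod_rposet A B) B"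
    by (rule right_mapsI)
      (use A.leq_carrier B.leq_carrier A.ract_closed B.ract_closed
        in \<open>auto simp: p_def prod_rposet_simps\<close>)
  show "compose (carrier B) p \<gamma> = (\<lambda>b\<in>carrier B. b)"
    using km(2) by (auto simp: compose_def \<gamma>_def p_def prod_rposet_simps restrict_def fun_eq_iff)
qed

section \<open>The empty \<open>S\<close>-poset and the map from \<open>B\<close> to
  \<open>A\<close>\<close>

text \<open>This is the initial \<open>S\<close>-poset; its axioms hold vacuously, whatever function
  is stored as the action.\<close>

lemma empty_right_sposet:
  assumes "pomonoid S"
  shows "right_sposet S \<lparr>carrier = {}, leq = {}, ract = a\<rparr>"
proof -
  interpret pomonoid S by fact
  show ?thesis by unfold_locales (auto simp: partial_order_on_def preorder_on_def)
qed

text \<open>On an empty carrier the constant \<open>undefined\<close> is the only extensional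
  function.\<close>

lemma empty_order_embedding:
  "(\<lambda>_. undefined) \<in> order_embeddings S \<lparr>carrier = {}, leq = {}, ract = a\<rparr> X"
  by (simp add: order_embeddings_def right_maps_def)

theorem proposition3p13:
  fixes S :: "'s pomonoid" and A :: "('s, 'a) rposet" and B :: "('s, 'b) rposet"
  assumes "pomonoid S" and "right_sposet S A" and "right_sposet S B"
    and "emb_injective S A \<or> (\<exists>f\<in>right_maps S A B. slice_emb_injective S A B f)"
  shows "generator TYPE('x) TYPE('y) (End_pomonoid S B) (Pos_hom S (prod_rposet A B) B)"
proof -
  let ?U = "\<lparr>carrier = {}, leq = {}, ract = \<lambda>x _. x\<rparr> :: ('s, 'b) rposet"
  note U = empty_right_sposet[OF assms(1), of "\<lambda>(x::'b) _. x"]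
  have h: "(\<lambda>_. undefined) \<in> order_embeddings S ?U B"
    and u: "(\<lambda>_. undefined) \<in> right_maps S ?U A"
    using empty_order_embedding order_embeddingsD(1) by blast+
  obtain k where k: "k \<in> right_maps S B A"
    using assms(4)
  proof
    assume "emb_injective S A"
    \<comment> \<open>\<open>emb_injective\<close> tests carriers in the type
      \<open>'s \<Rightarrow> 'a set\<close>, while \<open>B\<close> lives in \<open>'b\<close>; the
      extension theorem bridges the two types.\<close>
    from emb_injective_extension[OF assms(2) this U assms(3) h u] show thesis
      using that by blast
  next
    assume "\<exists>f\<in>right_maps S A B. slice_emb_injective S A B f"
    then obtain f where f: "f \<in> right_maps S A B" "slice_emb_injective S A B f" by blast
    \<comment> \<open>The identity of \<open>B\<close> is taken as the map to the base, and the
      square commutes because its source is empty. The lift obtained is a section of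
      \<open>f\<close>, in particular a map from \<open>B\<close> to \<open>A\<close>.\<close>
    have "compose (carrier ?U) f (\<lambda>_. undefined)
        = compose (carrier ?U) (\<lambda>b\<in>carrier B. b) (\<lambda>_. undefined)"
      by (simp add: compose_def restrict_def)
    from slice_emb_injective_extension[OF assms(2,3) f U assms(3) h u right_maps_id[OF assms(3)] this]
    show thesis using that by blast
  qed
  show ?thesis
    using generator_Pos_hom_of_retract[OF prod_right_sposet[OF assms(2,3)] assms(3)
      prod_snd_section[OF assms(2,3) k]] .
qed

end
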